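(* The class $\mathbf{Alg}\mathcal{LB}$ is the variety generated by $\mathcal{FOUR}$, i.e. the variety of distributive bilattices.
   Context: A bilattice is an algebra $\langle B,\land,\lor,\otimes,\oplus,\neg\rangle$ such that $\langle B,\land,\lor\rangle$ and $\langle B,\otimes,\oplus\rangle$ are lattices (not necessarily bounded) with associated orders $\leq_t$ and $\leq_k$, and $\neg$ is a unary operation such that for all $a,b$: $a\leq_t b$ implies $\neg b\leq_t\neg a$; $a\leq_k b$ implies $\neg a\leq_k\neg b$; $\neg\neg a=a$. It is distributive if $x\circ(y\bullet z)\approx(x\circ y)\bullet(x\circ z)$ holds for all distinct $\circ,\bullet\in\{\land,\lor,\otimes,\oplus\}$. $\mathcal{FOUR}$ is the bilattice with universe $\{\mathsf f,\bot,\top,\mathsf t\}$ with $\mathsf f <_t \bot,\top <_t \mathsf t$ ($\bot,\top$ $\leq_t$-incomparable), $\bot <_k \mathsf f,\mathsf t <_k \top$ ($\mathsf f,\mathsf t$ $\leq_k$-incomparable), and $\neg \mathsf f = \mathsf t$, $\neg\mathsf t=\mathsf f$, $\neg\bot=\bot$, $\neg\top=\top$. Let $\mathsf{Tr}=\{\top,\mathsf t\}$. $\mathbf{Fm}$ is the formula algebra over a countable set of variables in the language $\{\land,\lor,\otimes,\oplus,\neg\}$, and $\mathcal{LB}$ is the logic given by: $\Gamma\models_{\mathcal{LB}}\varphi$ iff for every homomorphism $h:\mathbf{Fm}\to\mathcal{FOUR}$, $h[\Gamma]\subseteq \mathsf{Tr}$ implies $h(\varphi)\in\mathsf{Tr}$.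 For an algebra $\mathbf A$ of this similarity type, a set $F\subseteq A$ is an $\mathcal{LB}$-filter if whenever $\Gamma\models_{\mathcal{LB}}\varphi$ and $h:\mathbf{Fm}\to\mathbf A$ is a homomorphism with $h[\Gamma]\subseteq F$, then $h(\varphi)\in F$. A g-matrix is a pair $\langle\mathbf A,\mathcal C\rangle$ with $\mathcal C$ a closure system on $A$; it is a g-model of $\mathcal{LB}$ if every member of $\mathcal C$ is an $\mathcal{LB}$-filter. Its Tarski congruence is the greatest congruence $\theta$ of $\mathbf A$ compatible with every $F\in\mathcal C$ (i.e. $a\in F$ and $\langle a,b\rangle\in\theta$ imply $b\in F$); the g-matrix is reduced if its Tarski congruence is the identity. $\mathbf{Alg}\mathcal{LB}$ is the class of all algebras $\mathbf A$ for which there is a reduced g-model $\langle\mathbf A,\mathcal C\rangle$ of $\mathcal{LB}$. *)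

theory Defs
  imports Main "HOL-Library.FuncSet"
begin

section \<open>Algebras with four binary operations and one unary operation\<close>

datatype bop = Meet | Join | Times | Plus

record 'a alg =
  carrier :: "'a set"
  bin :: "bop \<Rightarrow> 'a \<Rightarrow> 'a \<Rightarrow> 'a"
  neg :: "'a \<Rightarrow> 'a"

text \<open>Universes are nonempty. The operations are total functions on the underlying type,
  but only their values on the carrier matter.\<close>

definition algebra :: "'a alg \<Rightarrow> bool" where
  "algebra A \<longleftrightarrow> carrier A \<noteq> {} \<and>
     (\<forall>c. \<forall>x\<in>carrier A. \<forall>y\<in>carrier A. bin A c x y \<in> carrier A) \<and>
     (\<forall>x\<in>carrier A. neg A x \<in> carrier A)"

definition hom :: "'a alg \<Rightarrow> 'b alg \<Rightarrow> ('a \<Rightarrow> 'b) set" where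
  "hom A B = {h \<in> carrier A \<rightarrow> carrier B.
     (\<forall>c. \<forall>x\<in>carrier A. \<forall>y\<in>carrier A. h (bin A c x y) = bin B c (h x) (h y)) \<and>
     (\<forall>x\<in>carrier A. h (neg A x) = neg B (h x))}"

definition congruence :: "'a alg \<Rightarrow> ('a \<times> 'a) set \<Rightarrow> bool" where
  "congruence A \<theta> \<longleftrightarrow> equiv (carrier A) \<theta> \<and>
     (\<forall>c a b a' b'. (a, b) \<in> \<theta> \<longrightarrow> (a', b') \<in> \<theta> \<longrightarrow> (bin A c a a', bin A c b b') \<in> \<theta>) \<and>
     (\<forall>a b. (a, b) \<in> \<theta> \<longrightarrow> (neg A a, neg A b) \<in> \<theta>)"


section \<open>Bilattices\<close>

definition is_lattice :: "'a set \<Rightarrow> ('a \<Rightarrow> 'a \<Rightarrow> 'a) \<Rightarrow> ('a \<Rightarrow> 'a \<Rightarrow> 'a) \<Rightarrow> bool" where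
  "is_lattice L m j \<longleftrightarrow>
     (\<forall>x\<in>L. \<forall>y\<in>L. m x y = m y x \<and> j x y = j y x) \<and>
     (\<forall>x\<in>L. \<forall>y\<in>L. \<forall>z\<in>L. m (m x y) z = m x (m y z) \<and> j (j x y) z = j x (j y z)) \<and>
     (\<forall>x\<in>L. \<forall>y\<in>L. m x (j x y) = x \<and> j x (m x y) = x)"

definition le_t :: "'a alg \<Rightarrow> 'a \<Rightarrow> 'a \<Rightarrow> bool" where
  "le_t A x y \<longleftrightarrow> bin A Meet x y = x"

definition le_k :: "'a alg \<Rightarrow> 'a \<Rightarrow> 'a \<Rightarrow> bool" where
  "le_k A x y \<longleftrightarrow> bin A Times x y = x"

definition bilattice :: "'a alg \<Rightarrow> bool" where
  "bilattice A \<longleftrightarrow> algebra A \<and>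
     is_lattice (carrier A) (bin A Meet) (bin A Join) \<and>
     is_lattice (carrier A) (bin A Times) (bin A Plus) \<and>
     (\<forall>a\<in>carrier A. \<forall>b\<in>carrier A. le_t A a b \<longrightarrow> le_t A (neg A b) (neg A a)) \<and>
     (\<forall>a\<in>carrier A. \<forall>b\<in>carrier A. le_k A a b \<longrightarrow> le_k A (neg A a) (neg A b)) \<and>
     (\<forall>a\<in>carrier A. neg A (neg A a) = a)"

definition distributive_bilattice :: "'a alg \<Rightarrow> bool" where
  "distributive_bilattice A \<longleftrightarrow> bilattice A \<and>
     (\<forall>c d. c \<noteq> d \<longrightarrow> (\<forall>x\<in>carrier A. \<forall>y\<in>carrier A. \<forall>z\<in>carrier A.
        bin A c x (bin A d y z) = bin A d (bin A c x y) (bin A c x z)))"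


section \<open>The bilattice FOUR\<close>

datatype four = False4 | Bot4 | Top4 | True4

text \<open>Each of the two orders has a least element, a greatest element and two incomparable
  elements in between. Hence the infimum (supremum) of two elements is the smaller (greater)
  one if they are comparable, and the least (greatest) element of the order otherwise.\<close>

definition four_le_t :: "four \<Rightarrow> four \<Rightarrow> bool" where
  "four_le_t x y \<longleftrightarrow> x = y \<or> x = False4 \<or> y = True4"

definition four_le_k :: "four \<Rightarrow> four \<Rightarrow> bool" where
  "four_le_k x y \<longleftrightarrow> x = y \<or> x = Bot4 \<or> y = Top4"

fun four_bin :: "bop \<Rightarrow> four \<Rightarrow> four \<Rightarrow> four" where
  "four_bin Meet x y = (if four_le_t x y then x else if four_le_t y x then y else False4)"
| "four_bin Join x y = (if four_le_t x y then y else if four_le_t y x then x else True4)"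
| "four_bin Times x y = (if four_le_k x y then x else if four_le_k y x then y else Bot4)"
| "four_bin Plus x y = (if four_le_k x y then y else if four_le_k y x then x else Top4)"

fun four_neg :: "four \<Rightarrow> four" where
  "four_neg False4 = True4"
| "four_neg True4 = False4"
| "four_neg Bot4 = Bot4"
| "four_neg Top4 = Top4"

definition FOUR :: "four alg" where
  "FOUR = \<lparr>carrier = UNIV, bin = four_bin, neg = four_neg\<rparr>"

definition Tr :: "four set" where
  "Tr = {Top4, True4}"

lemma le_FOUR: "le_t FOUR = four_le_t" "le_k FOUR = four_le_k"
  by (auto simp: fun_eq_iff le_t_def le_k_def FOUR_def four_le_t_def four_le_k_def)

lemma bilattice_FOUR: "bilattice FOUR"
proof -
  have "is_lattice UNIV (four_bin Meet) (four_bin Join)"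
  proof -
    have "four_bin Meet x y = four_bin Meet y x \<and> four_bin Join x y = four_bin Join y x"
      "four_bin Meet x (four_bin Join x y) = x \<and> four_bin Join x (four_bin Meet x y) = x"
      for x y by (cases x; cases y; simp add: four_le_t_def)+
    moreover have "four_bin Meet (four_bin Meet x y) z = four_bin Meet x (four_bin Meet y z) \<and>
      four_bin Join (four_bin Join x y) z = four_bin Join x (four_bin Join y z)"
      for x y z by (cases x; cases y; cases z; simp add: four_le_t_def)
    ultimately show ?thesis unfolding is_lattice_def by blast
  qed
  moreover have "is_lattice UNIV (four_bin Times) (four_bin Plus)"
  proof -
    have "four_bin Times x y = four_bin Times y x \<and> four_bin Plus x y = four_bin Plus y x"
      "four_bin Times x (four_bin Plus x y) = x \<and> four_bin Plus x (four_bin Times x y) = x"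
      for x y by (cases x; cases y; simp add: four_le_k_def)+
    moreover have "four_bin Times (four_bin Times x y) z = four_bin Times x (four_bin Times y z) \<and>
      four_bin Plus (four_bin Plus x y) z = four_bin Plus x (four_bin Plus y z)"
      for x y z by (cases x; cases y; cases z; simp add: four_le_k_def)
    ultimately show ?thesis unfolding is_lattice_def by blast
  qed
  moreover have "four_neg (four_neg a) = a" for a by (cases a) auto
  moreover have "four_le_t a b \<Longrightarrow> four_le_t (four_neg b) (four_neg a)" for a b
    by (cases a; cases b) (auto simp: four_le_t_def)
  moreover have "four_le_k a b \<Longrightarrow> four_le_k (four_neg a) (four_neg b)" for a b
    by (cases a; cases b) (auto simp: four_le_k_def)
  ultimately show ?thesis
    unfolding bilattice_def le_FOUR
    by (simp add: FOUR_def algebra_def del: four_bin.simps)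
qed


section \<open>Formulas and the logic LB\<close>

datatype fm = Var nat | Bin bop fm fm | Neg fm

definition Fm :: "fm alg" where
  "Fm = \<lparr>carrier = UNIV, bin = Bin, neg = Neg\<rparr>"

definition LB_entails :: "fm set \<Rightarrow> fm \<Rightarrow> bool" where
  "LB_entails \<Gamma> \<phi> \<longleftrightarrow> (\<forall>h\<in>hom Fm FOUR. h ` \<Gamma> \<subseteq> Tr \<longrightarrow> h \<phi> \<in> Tr)"

definition LB_filter :: "'a alg \<Rightarrow> 'a set \<Rightarrow> bool" where
  "LB_filter A F \<longleftrightarrow> F \<subseteq> carrier A \<and>
     (\<forall>\<Gamma> \<phi>. LB_entails \<Gamma> \<phi> \<longrightarrow> (\<forall>h\<in>hom Fm A. h ` \<Gamma> \<subseteq> F \<longrightarrow> h \<phi> \<in> F))"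


section \<open>Generalized matrices and the class Alg LB\<close>

text \<open>The universe, as the intersection of the empty family, belongs to every closure system.\<close>

definition closure_system :: "'a set \<Rightarrow> 'a set set \<Rightarrow> bool" where
  "closure_system U C \<longleftrightarrow> C \<subseteq> Pow U \<and> U \<in> C \<and> (\<forall>D. D \<subseteq> C \<longrightarrow> D \<noteq> {} \<longrightarrow> \<Inter>D \<in> C)"

definition g_matrix :: "'a alg \<Rightarrow> 'a set set \<Rightarrow> bool" where
  "g_matrix A C \<longleftrightarrow> algebra A \<and> closure_system (carrier A) C"

definition LB_g_model :: "'a alg \<Rightarrow> 'a set set \<Rightarrow> bool" where
  "LB_g_model A C \<longleftrightarrow> g_matrix A C \<and> (\<forall>F\<in>C. LB_filter A F)"

definition compatible :: "('a \<times> 'a) set \<Rightarrow> 'a set \<Rightarrow> bool" where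
  "compatible \<theta> F \<longleftrightarrow> (\<forall>a b. a \<in> F \<longrightarrow> (a, b) \<in> \<theta> \<longrightarrow> b \<in> F)"

definition is_Tarski_congruence :: "'a alg \<Rightarrow> 'a set set \<Rightarrow> ('a \<times> 'a) set \<Rightarrow> bool" where
  "is_Tarski_congruence A C \<theta> \<longleftrightarrow>
     congruence A \<theta> \<and> (\<forall>F\<in>C. compatible \<theta> F) \<and>
     (\<forall>\<theta>'. congruence A \<theta>' \<and> (\<forall>F\<in>C. compatible \<theta>' F) \<longrightarrow> \<theta>' \<subseteq> \<theta>)"

definition reduced :: "'a alg \<Rightarrow> 'a set set \<Rightarrow> bool" where
  "reduced A C \<longleftrightarrow> is_Tarski_congruence A C (Id_on (carrier A))"

definition Alg_LB :: "'a alg set" where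
  "Alg_LB = {A. \<exists>C. LB_g_model A C \<and> reduced A C}"


section \<open>The variety generated by an algebra\<close>

text \<open>A variety is the class of all models of a set of equations. The variety generated by
  an algebra is the least variety containing it; the universe of the members may be taken
  from any type, which need not be that of the generating algebra.\<close>

definition satisfies :: "'a alg \<Rightarrow> fm \<times> fm \<Rightarrow> bool" where
  "satisfies A e \<longleftrightarrow> (\<forall>h\<in>hom Fm A. h (fst e) = h (snd e))"

definition models :: "(fm \<times> fm) set \<Rightarrow> 'a alg set" where
  "models E = {A. algebra A \<and> (\<forall>e\<in>E. satisfies A e)}"

definition variety_generated_by :: "'b alg \<Rightarrow> 'a alg set" where
  "variety_generated_by B = \<Inter>{models E | E. B \<in> models E}"

text \<open>The same variety in terms of class operators: homomorphic images of subalgebras of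
  powers.\<close>

definition hom_images :: "'b alg set \<Rightarrow> 'a alg set" where
  "hom_images K = {A. algebra A \<and> (\<exists>B\<in>K. \<exists>h\<in>hom B A. h ` carrier B = carrier A)}"

definition subalgebras :: "'a alg set \<Rightarrow> 'a alg set" where
  "subalgebras K = {B\<lparr>carrier := X\<rparr> | B X. B \<in> K \<and> X \<subseteq> carrier B \<and> algebra (B\<lparr>carrier := X\<rparr>)}"

definition power_alg :: "'i set \<Rightarrow> 'b alg \<Rightarrow> ('i \<Rightarrow> 'b) alg" where
  "power_alg I B = \<lparr>carrier = I \<rightarrow>\<^sub>E carrier B,
     bin = (\<lambda>c f g. \<lambda>i\<in>I. bin B c (f i) (g i)),
     neg = (\<lambda>f. \<lambda>i\<in>I. neg B (f i))\<rparr>"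

text \<open>The index sets are sets of functions from \<open>'a\<close> to \<open>'b\<close>. This loses no power: every
  algebra on \<open>'a\<close> in the variety is a homomorphic image of the free algebra
  over its universe, and that algebra embeds into the power of \<open>B\<close> indexed by the
  valuations of the generators in \<open>B\<close>.\<close>

definition HSP :: "'b alg \<Rightarrow> 'a alg set" where
  "HSP B = hom_images (subalgebras (range (\<lambda>I :: ('a \<Rightarrow> 'b) set. power_alg I B)))"

end

theory Submission
  imports Defs
begin

text \<open>The argument rests on one representation fact: distinct elements of a distributive
  bilattice are separated by a homomorphism into \<open>FOUR\<close>. A prime bifilter \<open>F\<close>, that is, a prime
  filter for both lattices, induces such a homomorphism, since \<open>x\<close> may be sent to the element of
  \<open>FOUR\<close> determined by the truth values of \<open>x \<in> F\<close> and \<open>\<not>x \<in> F\<close>; Zorn's lemma provides enough prime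
  bifilters. Separation embeds a distributive bilattice into a power of \<open>FOUR\<close>, and it shows that
  the g-matrix of all \<open>LB\<close>-filters is reduced. Conversely, in a g-model of \<open>LB\<close> the
  transitive closure of the pairs of values of the two sides of the equations of \<open>FOUR\<close> is a
  congruence compatible with all filters, so a reduced g-model satisfies these equations.\<close>

section \<open>Homomorphisms and equations\<close>

primrec eval :: "'a alg \<Rightarrow> (nat \<Rightarrow> 'a) \<Rightarrow> fm \<Rightarrow> 'a" where
  "eval A v (Var n) = v n"
| "eval A v (Bin c \<phi> \<psi>) = bin A c (eval A v \<phi>) (eval A v \<psi>)"
| "eval A v (Neg \<phi>) = neg A (eval A v \<phi>)"

lemma hom_bin:
  "h \<in> hom A B \<Longrightarrow> x \<in> carrier A \<Longrightarrow> y \<in> carrier A \<Longrightarrow> h (bin A c x y) = bin B c (h x) (h y)"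
  by (auto simp: hom_def)

lemma hom_neg: "h \<in> hom A B \<Longrightarrow> x \<in> carrier A \<Longrightarrow> h (neg A x) = neg B (h x)"
  by (auto simp: hom_def)

lemma hom_comp: "h \<in> hom A B \<Longrightarrow> g \<in> hom B C \<Longrightarrow> g \<circ> h \<in> hom A C"
  by (auto simp: hom_def Pi_iff)

lemma algebra_bin: "algebra A \<Longrightarrow> x \<in> carrier A \<Longrightarrow> y \<in> carrier A \<Longrightarrow> bin A c x y \<in> carrier A"
  by (auto simp: algebra_def)

lemma algebra_neg: "algebra A \<Longrightarrow> x \<in> carrier A \<Longrightarrow> neg A x \<in> carrier A"
  by (auto simp: algebra_def)

lemma algebra_FOUR: "algebra FOUR"
  by (simp add: algebra_def FOUR_def)

lemma hom_Fm_carrier: "h \<in> hom Fm A \<Longrightarrow> h \<phi> \<in> carrier A"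
  by (auto simp: hom_def Fm_def)

lemma hom_Fm_Bin: "h \<in> hom Fm A \<Longrightarrow> h (Bin c \<phi> \<psi>) = bin A c (h \<phi>) (h \<psi>)"
  by (auto simp: hom_def Fm_def)

lemma hom_Fm_Neg: "h \<in> hom Fm A \<Longrightarrow> h (Neg \<phi>) = neg A (h \<phi>)"
  by (auto simp: hom_def Fm_def)

lemma eval_carrier:
  assumes "algebra A" "\<And>n. v n \<in> carrier A"
  shows "eval A v \<phi> \<in> carrier A"
  by (induction \<phi>) (auto simp: assms algebra_bin algebra_neg)

lemma eval_hom:
  assumes "algebra A" "\<And>n. v n \<in> carrier A"
  shows "eval A v \<in> hom Fm A"
  using eval_carrier[of A v] assms by (auto simp: hom_def Fm_def)

lemma hom_Fm_ext:
  assumes "h \<in> hom Fm A" "k \<in> hom Fm A" "\<And>n. h (Var n) = k (Var n)"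
  shows "h \<phi> = k \<phi>"
  by (induction \<phi>) (auto simp: assms hom_Fm_Bin[OF assms(1)] hom_Fm_Bin[OF assms(2)]
      hom_Fm_Neg[OF assms(1)] hom_Fm_Neg[OF assms(2)])

lemma hom_Fm_eval: "h \<in> hom Fm A \<Longrightarrow> h \<phi> = eval A (h \<circ> Var) \<phi>"
  by (induction \<phi>) (auto simp: hom_Fm_Bin hom_Fm_Neg)

lemma satisfies_eval:
  assumes "algebra A" "satisfies A (\<phi>, \<psi>)" "\<And>n. v n \<in> carrier A"
  shows "eval A v \<phi> = eval A v \<psi>"
  using eval_hom[of A v] assms by (auto simp: satisfies_def)

lemma satisfies_FOUR_I:
  assumes "\<And>v. eval FOUR v \<phi> = eval FOUR v \<psi>"
  shows "satisfies FOUR (\<phi>, \<psi>)"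
  unfolding satisfies_def using assms hom_Fm_eval[of _ FOUR] by (metis fst_conv snd_conv)

text \<open>For an algebra, this says that it embeds into a power of \<open>FOUR\<close>, stated
  without mentioning the power.\<close>

definition FOUR_separated :: "'a alg \<Rightarrow> bool" where
  "FOUR_separated A \<longleftrightarrow>
     (\<forall>a\<in>carrier A. \<forall>b\<in>carrier A. a \<noteq> b \<longrightarrow> (\<exists>g\<in>hom A FOUR. g a \<noteq> g b))"

text \<open>A failing instance of the equation in \<open>A\<close> would be carried by a separating
  homomorphism to a failing instance in \<open>FOUR\<close>.\<close>

lemma FOUR_separated_satisfies:
  assumes A: "FOUR_separated A" and e: "satisfies FOUR e"
  shows "satisfies A e"
  unfolding satisfies_def
proof (intro ballI, rule ccontr)
  fix h assume h: "h \<in> hom Fm A" and "h (fst e) \<noteq> h (snd e)"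
  then obtain g where g: "g \<in> hom A FOUR" "g (h (fst e)) \<noteq> g (h (snd e))"
    using A hom_Fm_carrier[OF h] unfolding FOUR_separated_def by blast
  moreover have "g \<circ> h \<in> hom Fm FOUR"
    using hom_comp h g(1) by blast
  ultimately show False
    using e by (auto simp: satisfies_def)
qed

text \<open>The least model class containing \<open>FOUR\<close> is defined by all equations of
  \<open>FOUR\<close>. For the forward direction, the set of equations is taken to be empty or a
  singleton.\<close>

lemma in_variety_FOUR_iff:
  "A \<in> variety_generated_by FOUR \<longleftrightarrow> algebra A \<and> (\<forall>e. satisfies FOUR e \<longrightarrow> satisfies A e)"
proof
  assume A: "A \<in> variety_generated_by FOUR"
  have *: "A \<in> models E" if "\<forall>e\<in>E. satisfies FOUR e" for E
  proof -
    have "FOUR \<in> models E"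
      using that algebra_FOUR by (simp add: models_def)
    then show ?thesis
      using A unfolding variety_generated_by_def by blast
  qed
  have "algebra A"
    using *[of "{}"] by (simp add: models_def)
  moreover have "satisfies A e" if "satisfies FOUR e" for e
    using *[of "{e}"] that by (simp add: models_def)
  ultimately show "algebra A \<and> (\<forall>e. satisfies FOUR e \<longrightarrow> satisfies A e)"
    by blast
next
  assume "algebra A \<and> (\<forall>e. satisfies FOUR e \<longrightarrow> satisfies A e)"
  then have "A \<in> models E" if "FOUR \<in> models E" for E
    using that unfolding models_def by blast
  then show "A \<in> variety_generated_by FOUR"
    unfolding variety_generated_by_def by blast
qed

section \<open>The equations of distributive bilattices\<close>

text \<open>Serves identities in at most three variables: the valuation takes \<open>Var 0\<close>
  to \<open>x\<close>, \<open>Var 1\<close> to \<open>y\<close> and all other variables to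
  \<open>z\<close>, so all its values lie in the carrier.\<close>

lemma variety_FOUR_identity:
  assumes A: "A \<in> variety_generated_by FOUR"
    and e: "\<And>v. eval FOUR v \<phi> = eval FOUR v \<psi>"
    and xyz: "x \<in> carrier A" "y \<in> carrier A" "z \<in> carrier A"
  shows "eval A (case_nat x (case_nat y (\<lambda>_. z))) \<phi> = eval A (case_nat x (case_nat y (\<lambda>_. z))) \<psi>"
  using A xyz satisfies_FOUR_I[OF e]
  by (intro satisfies_eval) (auto simp: in_variety_FOUR_iff split: nat.split)

lemma four_bin_lattice:
  "four_bin c x y = four_bin c y x"
  "four_bin c (four_bin c x y) z = four_bin c x (four_bin c y z)"
  "four_bin Meet x (four_bin Join x y) = x" "four_bin Join x (four_bin Meet x y) = x"
  "four_bin Times x (four_bin Plus x y) = x" "four_bin Plus x (four_bin Times x y) = x"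
  by (cases c; cases x; cases y; cases z; simp add: four_le_t_def four_le_k_def)+

lemma four_bin_distrib:
  "c \<noteq> d \<Longrightarrow> four_bin c x (four_bin d y z) = four_bin d (four_bin c x y) (four_bin c x z)"
  by (cases c; cases d; cases x; cases y; cases z; simp add: four_le_t_def four_le_k_def)

lemma four_neg_bin:
  "four_neg (four_neg x) = x"
  "four_neg (four_bin Meet x y) = four_bin Join (four_neg x) (four_neg y)"
  "four_neg (four_bin Times x y) = four_bin Times (four_neg x) (four_neg y)"
  by (cases x; cases y; simp add: four_le_t_def four_le_k_def)+

lemma FOUR_simps: "bin FOUR = four_bin" "neg FOUR = four_neg" "carrier FOUR = UNIV"
  by (simp_all add: FOUR_def)

text \<open>The order conditions on negation are implications, not equations. They follow from two
  identities of \<open>FOUR\<close>: De Morgan's law for \<open>Meet\<close>, and negation commuting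
  with \<open>Times\<close>.\<close>

lemma variety_FOUR_distributive_bilattice:
  assumes A: "A \<in> variety_generated_by FOUR"
  shows "distributive_bilattice A"
proof -
  let ?x = "Var 0" and ?y = "Var 1" and ?z = "Var 2"
  have alg: "algebra A"
    using A by (simp add: in_variety_FOUR_iff)
  note id = variety_FOUR_identity[OF A]
  note simps = FOUR_simps numeral_2_eq_2
  have comm: "bin A c x y = bin A c y x"
    if "x \<in> carrier A" "y \<in> carrier A" for c x y
    using id[of "Bin c ?x ?y" "Bin c ?y ?x" x y y] that
    by (simp add: simps four_bin_lattice(1) del: four_bin.simps)
  have assoc: "bin A c (bin A c x y) z = bin A c x (bin A c y z)"
    if "x \<in> carrier A" "y \<in> carrier A" "z \<in> carrier A" for c x y z
    using id[of "Bin c (Bin c ?x ?y) ?z" "Bin c ?x (Bin c ?y ?z)" x y z] that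
    by (simp add: simps four_bin_lattice(2) del: four_bin.simps)
  have absorb: "bin A c x (bin A d x y) = x"
    if "x \<in> carrier A" "y \<in> carrier A" "(c, d) \<in> {(Meet, Join), (Join, Meet), (Times, Plus), (Plus, Times)}"
    for c d x y
    using id[of "Bin c ?x (Bin d ?x ?y)" ?x x y y] that
    by (auto simp add: simps four_bin_lattice(3-6) simp del: four_bin.simps)
  have distrib: "bin A c x (bin A d y z) = bin A d (bin A c x y) (bin A c x z)"
    if "x \<in> carrier A" "y \<in> carrier A" "z \<in> carrier A" "c \<noteq> d" for c d x y z
    using id[of "Bin c ?x (Bin d ?y ?z)" "Bin d (Bin c ?x ?y) (Bin c ?x ?z)" x y z] that
    by (simp add: simps four_bin_distrib[OF that(4)] del: four_bin.simps)
  have negneg: "neg A (neg A x) = x" if "x \<in> carrier A" for x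
    using id[of "Neg (Neg ?x)" ?x x x x] that by (simp add: simps four_neg_bin)
  have neg_Meet: "neg A (bin A Meet x y) = bin A Join (neg A x) (neg A y)"
    if "x \<in> carrier A" "y \<in> carrier A" for x y
    using id[of "Neg (Bin Meet ?x ?y)" "Bin Join (Neg ?x) (Neg ?y)" x y y] that
    by (simp add: simps four_neg_bin del: four_bin.simps)
  have neg_Times: "neg A (bin A Times x y) = bin A Times (neg A x) (neg A y)"
    if "x \<in> carrier A" "y \<in> carrier A" for x y
    using id[of "Neg (Bin Times ?x ?y)" "Bin Times (Neg ?x) (Neg ?y)" x y y] that
    by (simp add: simps four_neg_bin del: four_bin.simps)
  have "is_lattice (carrier A) (bin A Meet) (bin A Join)"
    "is_lattice (carrier A) (bin A Times) (bin A Plus)"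
    unfolding is_lattice_def using comm assoc absorb by auto
  moreover have "le_t A (neg A b) (neg A a)"
    if "a \<in> carrier A" "b \<in> carrier A" "le_t A a b" for a b
  proof -
    have "neg A a = bin A Join (neg A b) (neg A a)"
      using that neg_Meet[of a b] comm algebra_neg[OF alg] by (auto simp: le_t_def)
    then show ?thesis
      using absorb[of "neg A b" "neg A a" Meet Join] that algebra_neg[OF alg]
      by (simp add: le_t_def)
  qed
  moreover have "le_k A (neg A a) (neg A b)"
    if "a \<in> carrier A" "b \<in> carrier A" "le_k A a b" for a b
    using that neg_Times[of a b] by (simp add: le_k_def)
  ultimately show ?thesis
    using alg negneg distrib by (auto simp: distributive_bilattice_def bilattice_def)
qed

section \<open>Separation in distributive bilattices\<close>

text \<open>If the bilattice is represented as a product, with pairs ordered by \<open>\<le>\<close> in both coordinates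
  for the k-order and the second coordinate reversed for the t-order, then \<open>le_1\<close> compares first
  coordinates, and \<open>le_1\<close> on negations compares second coordinates.\<close>

definition le_1 :: "'a alg \<Rightarrow> 'a \<Rightarrow> 'a \<Rightarrow> bool" where
  "le_1 A x y \<longleftrightarrow> le_t A x (bin A Times x y)"

definition bifilter :: "'a alg \<Rightarrow> 'a set \<Rightarrow> bool" where
  "bifilter A F \<longleftrightarrow> F \<subseteq> carrier A \<and>
     (\<forall>x\<in>carrier A. \<forall>y\<in>carrier A. bin A Meet x y \<in> F \<longleftrightarrow> x \<in> F \<and> y \<in> F) \<and>
     (\<forall>x\<in>carrier A. \<forall>y\<in>carrier A. bin A Times x y \<in> F \<longleftrightarrow> x \<in> F \<and> y \<in> F)"

definition prime_bifilter :: "'a alg \<Rightarrow> 'a set \<Rightarrow> bool" where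
  "prime_bifilter A F \<longleftrightarrow> bifilter A F \<and>
     (\<forall>x\<in>carrier A. \<forall>y\<in>carrier A. bin A Join x y \<in> F \<longleftrightarrow> x \<in> F \<or> y \<in> F) \<and>
     (\<forall>x\<in>carrier A. \<forall>y\<in>carrier A. bin A Plus x y \<in> F \<longleftrightarrow> x \<in> F \<or> y \<in> F)"

text \<open>The arguments tell whether the value lies in \<open>Tr\<close> and whether its negation
  does. They present \<open>FOUR\<close> as a product of two two-element lattices, the second one
  reversed for the t-order, with negation swapping the coordinates.\<close>

fun four_of :: "bool \<Rightarrow> bool \<Rightarrow> four" where
  "four_of True True = Top4"
| "four_of True False = True4"
| "four_of False True = False4"
| "four_of False False = Bot4"

lemma four_of_bin:
  "four_bin Meet (four_of p q) (four_of p' q') = four_of (p \<and> p') (q \<or> q')"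
  "four_bin Join (four_of p q) (four_of p' q') = four_of (p \<or> p') (q \<and> q')"
  "four_bin Times (four_of p q) (four_of p' q') = four_of (p \<and> p') (q \<and> q')"
  "four_bin Plus (four_of p q) (four_of p' q') = four_of (p \<or> p') (q \<or> q')"
  by (cases p; cases q; cases p'; cases q'; simp add: four_le_t_def four_le_k_def)+

lemma four_of_neg: "four_neg (four_of p q) = four_of q p"
  by (cases p; cases q; simp)

lemma four_of_eq_iff: "four_of p q = four_of p' q' \<longleftrightarrow> p = p' \<and> q = q'"
  by (cases p; cases q; cases p'; cases q'; simp)

locale distr_bilattice =
  fixes A :: "'a alg"
  assumes distributive_bilattice: "distributive_bilattice A"
begin

abbreviation "U \<equiv> carrier A"
abbreviation "meet \<equiv> bin A Meet"
abbreviation "join \<equiv> bin A Join"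
abbreviation "ktimes \<equiv> bin A Times"
abbreviation "kplus \<equiv> bin A Plus"

section \<open>Laws of the two lattices and of negation\<close>

lemma bilattice: "bilattice A"
  using distributive_bilattice by (simp only: distributive_bilattice_def)

lemma alg: "algebra A"
  using bilattice by (simp only: bilattice_def)

lemma lattices:
  "is_lattice U meet join" "is_lattice U ktimes kplus"
  using bilattice by (simp_all only: bilattice_def)

lemma closed [simp]: "x \<in> U \<Longrightarrow> y \<in> U \<Longrightarrow> bin A c x y \<in> U" "x \<in> U \<Longrightarrow> neg A x \<in> U"
  using alg by (auto simp: algebra_def)

lemma comm: "x \<in> U \<Longrightarrow> y \<in> U \<Longrightarrow> bin A c x y = bin A c y x"
  using lattices unfolding is_lattice_def by (cases c) metis+

lemma assoc: "x \<in> U \<Longrightarrow> y \<in> U \<Longrightarrow> z \<in> U \<Longrightarrow> bin A c (bin A c x y) z = bin A c x (bin A c y z)"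
  using lattices unfolding is_lattice_def by (cases c) metis+

lemma absorb:
  assumes "x \<in> U" "y \<in> U"
  shows "meet x (join x y) = x" "join x (meet x y) = x"
    "ktimes x (kplus x y) = x" "kplus x (ktimes x y) = x"
  using lattices assms unfolding is_lattice_def by metis+

lemma idem [simp]: "x \<in> U \<Longrightarrow> bin A c x x = x"
  using absorb[of x] by (cases c) (metis closed(1))+

lemma distrib:
  assumes "c \<noteq> d" "x \<in> U" "y \<in> U" "z \<in> U"
  shows "bin A c x (bin A d y z) = bin A d (bin A c x y) (bin A c x z)"
    "bin A c (bin A d y z) x = bin A d (bin A c y x) (bin A c z x)"
proof -
  show *: "bin A c x (bin A d y z) = bin A d (bin A c x y) (bin A c x z)"
    using distributive_bilattice assms unfolding distributive_bilattice_def by blast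
  show "bin A c (bin A d y z) x = bin A d (bin A c y x) (bin A c z x)"
    using * assms comm[of y x c] comm[of z x c] comm[of "bin A d y z" x c] by simp
qed

lemma neg_neg [simp]: "x \<in> U \<Longrightarrow> neg A (neg A x) = x"
  using bilattice by (simp add: bilattice_def)

lemma join_iff_meet: "x \<in> U \<Longrightarrow> y \<in> U \<Longrightarrow> join x y = y \<longleftrightarrow> meet x y = x"
  by (metis absorb(1,2) comm)

lemma plus_iff_times: "x \<in> U \<Longrightarrow> y \<in> U \<Longrightarrow> kplus x y = y \<longleftrightarrow> ktimes x y = x"
  by (metis absorb(3,4) comm)

lemma neg_antimono: "x \<in> U \<Longrightarrow> y \<in> U \<Longrightarrow> meet x y = x \<Longrightarrow> meet (neg A y) (neg A x) = neg A y"
  using bilattice by (simp add: bilattice_def le_t_def)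

lemma neg_mono: "x \<in> U \<Longrightarrow> y \<in> U \<Longrightarrow> ktimes x y = x \<Longrightarrow> ktimes (neg A x) (neg A y) = neg A x"
  using bilattice by (simp add: bilattice_def le_k_def)

lemma meet_lower: "x \<in> U \<Longrightarrow> y \<in> U \<Longrightarrow> meet (meet x y) x = meet x y"
  by (metis assoc comm idem)

lemma times_lower: "x \<in> U \<Longrightarrow> y \<in> U \<Longrightarrow> ktimes (ktimes x y) x = ktimes x y"
  by (metis assoc comm idem)

lemma meet_greatest:
  "x \<in> U \<Longrightarrow> y \<in> U \<Longrightarrow> z \<in> U \<Longrightarrow> meet z (meet x y) = z \<longleftrightarrow> meet z x = z \<and> meet z y = z"
  by (metis assoc closed(1) comm idem)

lemma times_greatest:
  "x \<in> U \<Longrightarrow> y \<in> U \<Longrightarrow> z \<in> U \<Longrightarrow> ktimes z (ktimes x y) = z \<longleftrightarrow> ktimes z x = z \<and> ktimes z y = z"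
  by (metis assoc closed(1) comm idem)

lemma antisym: "x \<in> U \<Longrightarrow> y \<in> U \<Longrightarrow> bin A c x y = x \<Longrightarrow> bin A c y x = y \<Longrightarrow> x = y"
  by (metis comm)

text \<open>An order-reversing involution exchanges suprema and infima. For the second inequality,
  \<open>neg A ?m\<close> is an upper bound of \<open>x\<close> and \<open>y\<close>, hence above
  \<open>join x y\<close>.\<close>

lemma neg_join:
  assumes x: "x \<in> U" and y: "y \<in> U"
  shows "neg A (join x y) = meet (neg A x) (neg A y)"
proof -
  let ?m = "meet (neg A x) (neg A y)"
  have m: "?m \<in> U" using x y by simp
  have "meet x (join x y) = x" "meet y (join x y) = y"
    using absorb(1)[of x y] absorb(1)[of y x] x y comm[of x y Join] by auto
  then have 1: "meet (neg A (join x y)) ?m = neg A (join x y)"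
    using neg_antimono x y by (simp add: meet_greatest)
  have "meet ?m (neg A x) = ?m" "meet ?m (neg A y) = ?m"
    using meet_lower[of "neg A x" "neg A y"] meet_lower[of "neg A y" "neg A x"]
      comm[of "neg A x" "neg A y" Meet] x y by auto
  then have "meet x (neg A ?m) = x" "meet y (neg A ?m) = y"
    using neg_antimono[of ?m "neg A x"] neg_antimono[of ?m "neg A y"] x y m by auto
  then have "join x (neg A ?m) = neg A ?m" "join y (neg A ?m) = neg A ?m"
    using join_iff_meet x y m by auto
  then have "join (join x y) (neg A ?m) = neg A ?m"
    using x y m by (simp add: assoc)
  then have "meet (join x y) (neg A ?m) = join x y"
    using join_iff_meet x y m by simp
  then have "meet ?m (neg A (join x y)) = ?m"
    using neg_antimono[of "join x y" "neg A ?m"] x y m by simp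
  with 1 show ?thesis
    using antisym x y m by (metis closed)
qed

lemma neg_meet: "x \<in> U \<Longrightarrow> y \<in> U \<Longrightarrow> neg A (meet x y) = join (neg A x) (neg A y)"
  using neg_join[of "neg A x" "neg A y"] by (metis closed neg_neg)

text \<open>Monotonicity gives one inequality. The converse is the same inequality for
  \<open>neg A x\<close> and \<open>neg A y\<close>, negated once more; \<open>neg_plus\<close>
  follows this pattern.\<close>

lemma neg_times:
  assumes x: "x \<in> U" and y: "y \<in> U"
  shows "neg A (ktimes x y) = ktimes (neg A x) (neg A y)"
proof -
  have le: "ktimes (neg A (ktimes x y)) (ktimes (neg A x) (neg A y)) = neg A (ktimes x y)"
    if "x \<in> U" "y \<in> U" for x y
  proof -
    have "ktimes (ktimes x y) x = ktimes x y" "ktimes (ktimes x y) y = ktimes x y"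
      using times_lower[of x y] times_lower[of y x] comm[of x y Times] that by auto
    then show ?thesis
      using neg_mono that by (simp add: times_greatest)
  qed
  let ?m = "ktimes (neg A x) (neg A y)"
  have "ktimes (neg A ?m) (ktimes x y) = neg A ?m"
    using le[of "neg A x" "neg A y"] x y by simp
  then have "ktimes ?m (neg A (ktimes x y)) = ?m"
    using neg_mono[of "neg A ?m" "ktimes x y"] x y by simp
  with le[OF x y] show ?thesis
    using antisym x y by (metis closed)
qed

lemma neg_plus:
  assumes x: "x \<in> U" and y: "y \<in> U"
  shows "neg A (kplus x y) = kplus (neg A x) (neg A y)"
proof -
  have le: "kplus (kplus (neg A x) (neg A y)) (neg A (kplus x y)) = neg A (kplus x y)"
    if "x \<in> U" "y \<in> U" for x y
  proof -
    have "ktimes x (kplus x y) = x" "ktimes y (kplus x y) = y"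
      using absorb(3)[of x y] absorb(3)[of y x] that comm[of x y Plus] by auto
    then have "ktimes (neg A x) (neg A (kplus x y)) = neg A x"
      "ktimes (neg A y) (neg A (kplus x y)) = neg A y"
      using neg_mono that by auto
    then have "kplus (neg A x) (neg A (kplus x y)) = neg A (kplus x y)"
      "kplus (neg A y) (neg A (kplus x y)) = neg A (kplus x y)"
      using plus_iff_times that by auto
    then show ?thesis
      using that by (simp add: assoc)
  qed
  let ?m = "kplus (neg A x) (neg A y)"
  have "kplus (kplus x y) (neg A ?m) = neg A ?m"
    using le[of "neg A x" "neg A y"] x y by simp
  then have "ktimes (neg A (kplus x y)) ?m = neg A (kplus x y)"
    using neg_mono[of "kplus x y" "neg A ?m"] plus_iff_times[of "kplus x y" "neg A ?m"] x y by simp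
  then have "kplus (neg A (kplus x y)) ?m = ?m"
    using plus_iff_times x y by simp
  with le[OF x y] show ?thesis
    using x y by (metis closed comm)
qed

section \<open>The preorder \<open>le_1\<close>\<close>

lemma le_1_iff_t: "le_1 A x y \<longleftrightarrow> meet x (ktimes x y) = x"
  by (simp add: le_1_def le_t_def)

text \<open>Distributing \<open>ktimes x\<close> over \<open>meet x y\<close> gives
  \<open>meet x (ktimes x y)\<close>. So the two orders enter \<open>le_1\<close> symmetrically, and
  each later property uses the form that suits its operation.\<close>

lemma le_1_iff_k: "x \<in> U \<Longrightarrow> y \<in> U \<Longrightarrow> le_1 A x y \<longleftrightarrow> ktimes x (meet x y) = x"
  by (simp add: le_1_iff_t distrib(1)[of Times Meet])

lemma le_1_refl: "x \<in> U \<Longrightarrow> le_1 A x x"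
  by (simp add: le_1_iff_t)

text \<open>As \<open>ktimes x\<close> preserves \<open>meet\<close>, the claim reduces to the
  infimum property of the t-order; \<open>le_1_times\<close> is the mirror image in the
  k-order.\<close>

lemma le_1_meet:
  "x \<in> U \<Longrightarrow> y \<in> U \<Longrightarrow> z \<in> U \<Longrightarrow> le_1 A x (meet y z) \<longleftrightarrow> le_1 A x y \<and> le_1 A x z"
  by (simp add: le_1_iff_t distrib(1)[of Times Meet] meet_greatest)

lemma le_1_times:
  "x \<in> U \<Longrightarrow> y \<in> U \<Longrightarrow> z \<in> U \<Longrightarrow> le_1 A x (ktimes y z) \<longleftrightarrow> le_1 A x y \<and> le_1 A x z"
  by (simp add: le_1_iff_k distrib(1)[of Meet Times] times_greatest)

text \<open>Joining the t-inequalities \<open>x \<le> ktimes x z\<close> and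
  \<open>y \<le> ktimes y z\<close> gives the required one, since \<open>ktimes\<close> distributes
  over \<open>join\<close>. The k-form gives \<open>le_1_plus\<close> likewise.\<close>

lemma le_1_join:
  assumes "x \<in> U" "y \<in> U" "z \<in> U" "le_1 A x z" "le_1 A y z"
  shows "le_1 A (join x y) z"
proof -
  have *: "join x (ktimes x z) = ktimes x z" "join y (ktimes y z) = ktimes y z"
    using assms by (auto simp: le_1_iff_t join_iff_meet)
  have "join (join x y) (ktimes (join x y) z) = join (join x (ktimes x z)) (join y (ktimes y z))"
    using assms by (simp add: distrib(2)[of Times Join]) (metis assoc closed(1) comm)
  also have "\<dots> = ktimes (join x y) z"
    unfolding * using assms by (simp add: distrib(2)[of Times Join])
  finally show ?thesis
    using assms by (simp add: le_1_iff_t join_iff_meet)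
qed

lemma le_1_plus:
  assumes "x \<in> U" "y \<in> U" "z \<in> U" "le_1 A x z" "le_1 A y z"
  shows "le_1 A (kplus x y) z"
proof -
  have *: "kplus x (meet x z) = meet x z" "kplus y (meet y z) = meet y z"
    using assms by (auto simp: le_1_iff_k plus_iff_times)
  have "kplus (kplus x y) (meet (kplus x y) z) = kplus (kplus x (meet x z)) (kplus y (meet y z))"
    using assms by (simp add: distrib(2)[of Meet Plus]) (metis assoc closed(1) comm)
  also have "\<dots> = meet (kplus x y) z"
    unfolding * using assms by (simp add: distrib(2)[of Meet Plus])
  finally show ?thesis
    using assms by (simp add: le_1_iff_k plus_iff_times)
qed

text \<open>This is antisymmetry of the product order: \<open>le_1\<close> on elements and on their
  negations compares both coordinates.\<close>

lemma le_1_eqI: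
  assumes xy: "x \<in> U" "y \<in> U" and "le_1 A x y" "le_1 A y x"
    and "le_1 A (neg A x) (neg A y)" "le_1 A (neg A y) (neg A x)"
  shows "x = y"
proof -
  \<comment> \<open>The first comparison puts \<open>x\<close> t-below \<open>ktimes x y\<close>;
    the one on negations, after negating, puts it t-above.\<close>
  have *: "x = ktimes x y" if xy: "x \<in> U" "y \<in> U" "le_1 A x y" "le_1 A (neg A x) (neg A y)" for x y
  proof -
    have "meet (neg A x) (neg A (ktimes x y)) = neg A x"
      using that by (simp add: le_1_iff_t neg_times)
    then have "meet (ktimes x y) x = ktimes x y"
      using neg_antimono[of "neg A x" "neg A (ktimes x y)"] that by simp
    then show ?thesis
      using that antisym[of x "ktimes x y" Meet] by (simp add: le_1_iff_t)
  qed
  show ?thesis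
    using *[of x y] *[of y x] assms comm[of x y Times] by metis
qed

section \<open>Bifilters and the prime bifilter theorem\<close>

lemma bifilter_le_1:
  assumes "bifilter A F" "x \<in> F" "y \<in> U" "le_1 A x y"
  shows "y \<in> F"
proof -
  have "x \<in> U" "meet x (ktimes x y) \<in> F"
    using assms by (auto simp: bifilter_def le_1_iff_t)
  then show ?thesis
    using assms unfolding bifilter_def by (metis closed(1))
qed

lemma bifilter_principal: "a \<in> U \<Longrightarrow> bifilter A {x \<in> U. le_1 A a x}"
  by (auto simp: bifilter_def le_1_meet le_1_times)

text \<open>The elements above \<open>x\<close> form a bifilter, and bifilters are closed upwards
  under \<open>le_1\<close>.\<close>

lemma le_1_trans:
  assumes "x \<in> U" "y \<in> U" "z \<in> U" "le_1 A x y" "le_1 A y z"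
  shows "le_1 A x z"
  using bifilter_le_1[OF bifilter_principal[of x]] assms by blast

lemma le_1_meet_left:
  assumes "x \<in> U" "y \<in> U" "z \<in> U" "le_1 A x z"
  shows "le_1 A (meet y x) z"
  using assms le_1_meet[of "meet y x" y x] by (meson closed(1) le_1_refl le_1_trans)

text \<open>For nonempty \<open>F\<close> this is the bifilter generated by \<open>F\<close> and
  \<open>x\<close>.\<close>

lemma bifilter_adjoin:
  assumes F: "bifilter A F" and x: "x \<in> U"
  shows "bifilter A {z \<in> U. \<exists>f\<in>F. le_1 A (meet f x) z}" (is "bifilter A ?G")
proof -
  have FU: "f \<in> U" if "f \<in> F" for f
    using F that by (auto simp: bifilter_def)
  \<comment> \<open>Two witnesses from \<open>F\<close> are merged into their meet, which serves for
    both elements.\<close>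
  have both: "\<exists>f\<in>F. le_1 A (meet f x) y \<and> le_1 A (meet f x) z"
    if yz: "y \<in> U" "z \<in> U" and "f \<in> F" "le_1 A (meet f x) y" "g \<in> F" "le_1 A (meet g x) z" for y z f g
  proof
    have U: "f \<in> U" "g \<in> U" using FU that by auto
    show "meet f g \<in> F" using F that U by (auto simp: bifilter_def)
    have "le_1 A (meet (meet f g) x) (meet f x)" "le_1 A (meet (meet f g) x) (meet g x)"
      using U x le_1_refl[of "meet (meet f g) x"] by (auto simp: le_1_meet)
    then show "le_1 A (meet (meet f g) x) y \<and> le_1 A (meet (meet f g) x) z"
      using U x that le_1_trans by (meson closed(1))
  qed
  show ?thesis
    unfolding bifilter_def using FU x
    by (auto simp: le_1_meet le_1_times intro: both)
qed

text \<open>The prime filter theorem for \<open>le_1\<close>: a bifilter maximal among those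
  containing \<open>a\<close> and omitting \<open>b\<close> is prime, by distributivity.\<close>

lemma prime_bifilter_exists:
  assumes ab: "a \<in> U" "b \<in> U" "\<not> le_1 A a b"
  obtains F where "prime_bifilter A F" "a \<in> F" "b \<notin> F"
proof -
  define S where "S = {F. bifilter A F \<and> a \<in> F \<and> b \<notin> F}"
  have "{x \<in> U. le_1 A a x} \<in> S"
    using ab bifilter_principal[of a] le_1_refl by (auto simp: S_def)
  then have "S \<noteq> {}"
    by blast
  moreover have "\<Union>C \<in> S" if "C \<noteq> {}" "subset.chain S C" for C
  proof -
    have C: "bifilter A F" "a \<in> F" "b \<notin> F" if "F \<in> C" for F
      using \<open>subset.chain S C\<close> that by (auto simp: subset.chain_def S_def)
    \<comment> \<open>In a chain, the larger of two members contains both elements, so the union is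
      closed under the binary infima.\<close>
    have dir: "\<exists>H\<in>C. x \<in> H \<and> y \<in> H" if "F \<in> C" "x \<in> F" "G \<in> C" "y \<in> G" for F G x y
      using \<open>subset.chain S C\<close> that unfolding subset_chain_def by blast
    have "bifilter A (\<Union>C)"
      unfolding bifilter_def
    proof (intro conjI ballI)
      show "\<Union>C \<subseteq> U" using C(1) unfolding bifilter_def by blast
      fix x y assume "x \<in> U" "y \<in> U"
      then have iff: "meet x y \<in> F \<longleftrightarrow> x \<in> F \<and> y \<in> F" "ktimes x y \<in> F \<longleftrightarrow> x \<in> F \<and> y \<in> F" if "F \<in> C" for F
        using C(1)[OF that] by (auto simp: bifilter_def)
      show "meet x y \<in> \<Union>C \<longleftrightarrow> x \<in> \<Union>C \<and> y \<in> \<Union>C" "ktimes x y \<in> \<Union>C \<longleftrightarrow> x \<in> \<Union>C \<and> y \<in> \<Union>C"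
        using iff dir by (meson UnionE UnionI)+
    qed
    then show ?thesis
      using C that(1) by (auto simp: S_def)
  qed
  ultimately obtain F where "F \<in> S" and max: "\<And>G. G \<in> S \<Longrightarrow> F \<subseteq> G \<Longrightarrow> G = F"
    using subset_Zorn_nonempty[of S] by blast
  then have F: "bifilter A F" "a \<in> F" "b \<notin> F"
    by (auto simp: S_def)
  have FU: "f \<in> U" if "f \<in> F" for f
    using F that by (auto simp: bifilter_def)
  \<comment> \<open>Adjoining an outside element properly enlarges \<open>F\<close>, so by
    maximality the result contains \<open>b\<close>.\<close>
  have below: "\<exists>f\<in>F. le_1 A (meet f x) b" if x: "x \<in> U" "x \<notin> F" for x
  proof -
    let ?G = "{z \<in> U. \<exists>f\<in>F. le_1 A (meet f x) z}"
    have le: "le_1 A (meet f x) f" "le_1 A (meet f x) x" if "f \<in> F" for f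
      using le_1_refl[of "meet f x"] le_1_meet[of "meet f x" f x] FU[OF that] x by auto
    have "F \<subseteq> ?G" "x \<in> ?G"
      using le FU x F(2) by blast+
    moreover have "bifilter A ?G"
      using bifilter_adjoin F(1) x by blast
    ultimately have "b \<in> ?G"
      using max[of ?G] F(2) x by (auto simp: S_def)
    then show ?thesis by blast
  qed
  \<comment> \<open>If both were outside, a common \<open>?h\<close> in \<open>F\<close> would have
    its meets with \<open>x\<close> and with \<open>y\<close> below \<open>b\<close>; distributing
    \<open>meet ?h\<close> over either supremum would then force \<open>b\<close> into
    \<open>F\<close>.\<close>
  have prime: "x \<in> F \<or> y \<in> F" if xy: "x \<in> U" "y \<in> U" and c: "c \<in> {Join, Plus}" "bin A c x y \<in> F" for x y c
  proof (rule ccontr)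
    assume "\<not> (x \<in> F \<or> y \<in> F)"
    then obtain f g where fg: "f \<in> F" "le_1 A (meet f x) b" "g \<in> F" "le_1 A (meet g y) b"
      using below xy by blast
    let ?h = "meet f g"
    have U: "f \<in> U" "g \<in> U" using FU fg by auto
    have "le_1 A (meet ?h x) b" "le_1 A (meet ?h y) b"
      using le_1_meet_left[of "meet f x" g b] le_1_meet_left[of "meet g y" f b] fg U xy ab
        comm[of f g Meet] assoc[of g f x Meet] assoc[of f g y Meet] by simp_all
    then have "le_1 A (meet ?h (bin A c x y)) b"
      using le_1_join[of "meet ?h x" "meet ?h y" b] le_1_plus[of "meet ?h x" "meet ?h y" b]
        c(1) U xy ab distrib(1)[of Meet c ?h x y] by auto
    moreover have "meet ?h (bin A c x y) \<in> F"
      using F(1) fg c(2) U xy by (simp add: bifilter_def)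
    ultimately show False
      using bifilter_le_1 F ab by blast
  qed
  have up: "bin A c x y \<in> F" if "x \<in> U" "y \<in> U" "c \<in> {Join, Plus}" "x \<in> F" for x y c
  proof -
    have "meet x (join x y) = x" "ktimes x (kplus x y) = x"
      using absorb that by auto
    then show ?thesis
      using F(1) that unfolding bifilter_def by (metis closed(1) insertE singletonD)
  qed
  have "prime_bifilter A F"
    using F(1) prime up comm[where c = Join] comm[where c = Plus]
    unfolding prime_bifilter_def by (metis insertI1 insertI2)
  then show thesis
    using that F by blast
qed

text \<open>The De Morgan laws make the second coordinate follow \<open>four_of_bin\<close>:
  negation turns \<open>meet\<close> into \<open>join\<close>, hence conjunction into disjunction,
  but leaves \<open>ktimes\<close> and \<open>kplus\<close> in place.\<close>

lemma prime_bifilter_hom: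
  assumes F: "prime_bifilter A F"
  shows "(\<lambda>x. four_of (x \<in> F) (neg A x \<in> F)) \<in> hom A FOUR"
proof -
  have "four_of (bin A c x y \<in> F) (neg A (bin A c x y) \<in> F) =
      four_bin c (four_of (x \<in> F) (neg A x \<in> F)) (four_of (y \<in> F) (neg A y \<in> F))"
    if "x \<in> U" "y \<in> U" for c x y
    using F that
    by (cases c) (auto simp: prime_bifilter_def bifilter_def four_of_bin neg_meet neg_join
        neg_times neg_plus simp del: four_bin.simps)
  then show ?thesis
    by (simp add: hom_def FOUR_simps four_of_neg)
qed

text \<open>By \<open>le_1_eqI\<close>, distinct elements fail one of four comparisons, and a prime
  bifilter witnessing the failure tells apart the elements or their negations.\<close>

lemma separated: "FOUR_separated A"
  unfolding FOUR_separated_def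
proof (intro ballI impI)
  fix a b assume ab: "a \<in> U" "b \<in> U" "a \<noteq> b"
  have sep: "\<exists>g\<in>hom A FOUR. g a \<noteq> g b"
    if "prime_bifilter A F" "\<not> (a \<in> F \<longleftrightarrow> b \<in> F) \<or> \<not> (neg A a \<in> F \<longleftrightarrow> neg A b \<in> F)" for F
    using that(2) by (intro bexI[OF _ prime_bifilter_hom[OF that(1)]]) (auto simp: four_of_eq_iff)
  consider "\<not> le_1 A a b" | "\<not> le_1 A b a" | "\<not> le_1 A (neg A a) (neg A b)"
    | "\<not> le_1 A (neg A b) (neg A a)"
    using le_1_eqI ab by blast
  then show "\<exists>g\<in>hom A FOUR. g a \<noteq> g b"
    by cases (use ab sep in \<open>metis closed(2) prime_bifilter_exists\<close>)+
qed

end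

section \<open>Homomorphic images of subalgebras of powers\<close>

text \<open>Evaluation embeds \<open>A\<close> into a power of \<open>FOUR\<close>, and
  \<open>A\<close> is the image of its copy under the inverse map.\<close>

lemma separated_in_HSP:
  fixes A :: "'a alg"
  assumes alg: "algebra A" and sep: "FOUR_separated A"
  shows "A \<in> HSP FOUR"
proof -
  \<comment> \<open>Homomorphisms from \<open>A\<close> are functions from \<open>'a\<close> to
    \<open>four\<close>, so they form an index set of the type used in \<open>HSP\<close>.\<close>
  define I where "I = hom A FOUR"
  define e where "e a = (\<lambda>h\<in>I. h a)" for a
  define B where "B = (power_alg I FOUR)\<lparr>carrier := e ` carrier A\<rparr>"
  have inj: "inj_on e (carrier A)"
  proof (rule inj_onI, rule ccontr)
    fix a b assume ab: "a \<in> carrier A" "b \<in> carrier A" "e a = e b" "a \<noteq> b"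
    then obtain h where "h \<in> I" "h a \<noteq> h b"
      using sep by (auto simp: FOUR_separated_def I_def)
    then show False
      using fun_cong[OF ab(3), of h] by (simp add: e_def)
  qed
  have e_bin: "bin B c (e x) (e y) = e (bin A c x y)" if "x \<in> carrier A" "y \<in> carrier A" for c x y
    using that by (auto simp: B_def power_alg_def e_def I_def hom_bin)
  have e_neg: "neg B (e x) = e (neg A x)" if "x \<in> carrier A" for x
    using that by (auto simp: B_def power_alg_def e_def I_def hom_neg)
  have B_carrier: "carrier B = e ` carrier A"
    by (simp add: B_def)
  have "algebra B"
    using alg by (auto simp: algebra_def B_carrier e_bin e_neg)
  moreover have "e ` carrier A \<subseteq> carrier (power_alg I FOUR)"
    by (auto simp: power_alg_def FOUR_simps e_def)
  ultimately have "B \<in> subalgebras (range (\<lambda>I. power_alg I FOUR))"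
    unfolding subalgebras_def B_def by blast
  moreover have "inv_into (carrier A) e \<in> hom B A" "inv_into (carrier A) e ` carrier B = carrier A"
    using inj alg
    by (auto simp: hom_def B_carrier e_bin e_neg algebra_bin algebra_neg inv_into_f_f)
  ultimately show ?thesis
    using alg unfolding HSP_def hom_images_def by blast
qed

text \<open>Projections separate the points of a subalgebra of a power, so it satisfies the
  equations of \<open>FOUR\<close>; these then pass to the homomorphic image.\<close>

lemma HSP_in_variety:
  fixes A :: "'a alg"
  assumes "A \<in> HSP FOUR"
  shows "A \<in> variety_generated_by FOUR"
proof -
  obtain I :: "('a \<Rightarrow> four) set" and X h where A: "algebra A"
    and X: "X \<subseteq> carrier (power_alg I FOUR)" "algebra ((power_alg I FOUR)\<lparr>carrier := X\<rparr>)"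
    and h: "h \<in> hom ((power_alg I FOUR)\<lparr>carrier := X\<rparr>) A" "h ` X = carrier A"
    using assms unfolding HSP_def hom_images_def subalgebras_def by auto
  let ?B = "(power_alg I FOUR)\<lparr>carrier := X\<rparr>"
  have "(\<lambda>f. f i) \<in> hom ?B FOUR" if "i \<in> I" for i
    using that by (auto simp: hom_def power_alg_def FOUR_simps)
  moreover have "\<exists>i\<in>I. f i \<noteq> g i" if "f \<in> X" "g \<in> X" "f \<noteq> g" for f g
    using X(1) that PiE_ext[of f I _ g] unfolding power_alg_def by (simp add: subset_iff) metis
  ultimately have sep: "FOUR_separated ?B"
    unfolding FOUR_separated_def by (simp (no_asm)) metis
  have "satisfies A e" if e: "satisfies FOUR e" for e
    unfolding satisfies_def
  proof
    fix k assume k: "k \<in> hom Fm A"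
    \<comment> \<open>Chosen preimages of the values of the variables lift \<open>k\<close> along
      the surjection \<open>h\<close>.\<close>
    define v where "v n = inv_into X h (k (Var n))" for n
    have v: "v n \<in> carrier ?B" "h (v n) = k (Var n)" for n
      using hom_Fm_carrier[OF k, of "Var n"] h(2)
      by (auto simp: v_def inv_into_into f_inv_into_f)
    have ev: "eval ?B v \<in> hom Fm ?B"
      using eval_hom[OF X(2), of v] v(1) by blast
    have "k \<phi> = (h \<circ> eval ?B v) \<phi>" for \<phi>
      using hom_Fm_ext[OF k hom_comp[OF ev h(1)]] v(2) by simp
    then show "k (fst e) = k (snd e)"
      using FOUR_separated_satisfies[OF sep e] ev by (simp add: satisfies_def)
  qed
  with A show ?thesis
    by (simp add: in_variety_FOUR_iff)
qed

section \<open>Reduced g-models\<close>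

lemma separated_in_Alg_LB:
  assumes alg: "algebra A" and sep: "FOUR_separated A"
  shows "A \<in> Alg_LB"
proof -
  define C where "C = {F. LB_filter A F}"
  have "closure_system (carrier A) C"
    unfolding closure_system_def
  proof (intro conjI allI impI)
    show "C \<subseteq> Pow (carrier A)" by (auto simp: C_def LB_filter_def)
    show "carrier A \<in> C" by (auto simp: C_def LB_filter_def hom_Fm_carrier)
    fix D assume "D \<subseteq> C" "D \<noteq> {}"
    then have D: "LB_filter A F" if "F \<in> D" for F
      using that by (auto simp: C_def)
    have "\<Inter>D \<subseteq> carrier A"
      using D \<open>D \<noteq> {}\<close> by (auto simp: LB_filter_def)
    moreover have "h \<phi> \<in> \<Inter>D"
      if "LB_entails \<Gamma> \<phi>" "h \<in> hom Fm A" "h ` \<Gamma> \<subseteq> \<Inter>D" for \<Gamma> \<phi> h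
    proof
      fix F assume "F \<in> D"
      then show "h \<phi> \<in> F"
        using D[of F] that unfolding LB_filter_def by (meson Inter_lower subset_trans)
    qed
    ultimately show "\<Inter>D \<in> C"
      by (auto simp: C_def LB_filter_def)
  qed
  then have "LB_g_model A C"
    using alg by (auto simp: LB_g_model_def g_matrix_def C_def)
  moreover have "congruence A (Id_on (carrier A))"
    using alg by (auto simp: congruence_def equiv_def refl_on_def sym_def trans_def algebra_bin algebra_neg)
  moreover have "\<theta> \<subseteq> Id_on (carrier A)"
    if \<theta>: "congruence A \<theta>" and comp: "\<forall>F\<in>C. compatible \<theta> F" for \<theta>
  proof
    fix p assume "p \<in> \<theta>"
    then obtain a b where p: "p = (a, b)" and ab: "(a, b) \<in> \<theta>" by (cases p) auto
    have U: "a \<in> carrier A" "b \<in> carrier A"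
      using \<theta> ab by (auto simp: congruence_def equiv_def)
    have "a = b"
    proof (rule ccontr)
      assume "a \<noteq> b"
      then obtain g where g: "g \<in> hom A FOUR" "g a \<noteq> g b"
        using sep U by (auto simp: FOUR_separated_def)
      \<comment> \<open>The preimage of \<open>Tr\<close> is an \<open>LB\<close>-filter because
        valuations in \<open>A\<close> compose with \<open>g\<close> to valuations in
        \<open>FOUR\<close>.\<close>
      define F where "F = {x \<in> carrier A. g x \<in> Tr}"
      have "LB_filter A F"
        unfolding LB_filter_def
      proof (intro conjI allI impI ballI)
        show "F \<subseteq> carrier A" by (auto simp: F_def)
        fix \<Gamma> \<phi> h assume h: "LB_entails \<Gamma> \<phi>" "h \<in> hom Fm A" "h ` \<Gamma> \<subseteq> F"
        then have "g \<circ> h \<in> hom Fm FOUR" "(g \<circ> h) ` \<Gamma> \<subseteq> Tr"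
          using hom_comp g(1) by (auto simp: F_def)
        then have "(g \<circ> h) \<phi> \<in> Tr"
          using h(1) unfolding LB_entails_def by blast
        then show "h \<phi> \<in> F"
          using hom_Fm_carrier[OF h(2)] by (simp add: F_def)
      qed
      then have F: "x \<in> F \<longleftrightarrow> y \<in> F" if "(x, y) \<in> \<theta>" for x y
        using comp that \<theta> unfolding C_def compatible_def congruence_def equiv_def sym_def by blast
      have "(neg A a, neg A b) \<in> \<theta>"
        using \<theta> ab by (auto simp: congruence_def)
      \<comment> \<open>Membership of a value and of its negation in \<open>Tr\<close> together
        determine an element of \<open>FOUR\<close>; \<open>Tr\<close> alone would not tell
        \<open>Top4\<close> from \<open>True4\<close>.\<close>
      then have "g a \<in> Tr \<longleftrightarrow> g b \<in> Tr" "four_neg (g a) \<in> Tr \<longleftrightarrow> four_neg (g b) \<in> Tr"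
        using F[OF ab] F[of "neg A a" "neg A b"] U alg hom_neg[OF g(1)]
        by (auto simp: F_def algebra_neg FOUR_simps)
      then show False
        using g(2) by (cases "g a"; cases "g b") (auto simp: Tr_def)
    qed
    then show "p \<in> Id_on (carrier A)"
      using p U by auto
  qed
  moreover have "compatible (Id_on (carrier A)) F" for F
    by (auto simp: compatible_def)
  ultimately have "LB_g_model A C" "reduced A C"
    by (simp_all add: reduced_def is_Tarski_congruence_def)
  then show ?thesis
    unfolding Alg_LB_def by blast
qed

text \<open>For an algebra, the transitive closure is the least congruence whose quotient satisfies
  the equations of \<open>FOUR\<close>. The closure is taken because consecutive pairs may come from
  different homomorphisms and formulas.\<close>

definition FOUR_pairs :: "'a alg \<Rightarrow> ('a \<times> 'a) set" where
  "FOUR_pairs A = {(h \<phi>, h \<psi>) | h \<phi> \<psi>. h \<in> hom Fm A \<and> satisfies FOUR (\<phi>, \<psi>)}"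

text \<open>The variables are shifted so that the parameter \<open>a\<close> can become the value of a fresh
  variable.\<close>

lemma FOUR_pairs_fresh:
  assumes alg: "algebra A" and xy: "(x, y) \<in> FOUR_pairs A" and a: "a \<in> carrier A"
  obtains h \<phi> \<psi> where "h \<in> hom Fm A" "satisfies FOUR (\<phi>, \<psi>)" "h \<phi> = x" "h \<psi> = y" "h (Var 0) = a"
proof -
  obtain k \<phi> \<psi> where k: "k \<in> hom Fm A" "satisfies FOUR (\<phi>, \<psi>)" "x = k \<phi>" "y = k \<psi>"
    using xy by (auto simp: FOUR_pairs_def)
  define r where "r = eval Fm (Var \<circ> Suc)"
  have r: "r \<in> hom Fm Fm"
    unfolding r_def by (rule eval_hom) (auto simp: algebra_def Fm_def)
  define h where "h = eval A (case_nat a (k \<circ> Var))"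
  have h: "h \<in> hom Fm A"
    unfolding h_def using alg a hom_Fm_carrier[OF k(1)] by (intro eval_hom) (auto split: nat.split)
  have "(h \<circ> r) \<chi> = k \<chi>" for \<chi>
    using hom_Fm_ext[OF hom_comp[OF r h] k(1)] by (simp add: r_def h_def)
  moreover have "satisfies FOUR (r \<phi>, r \<psi>)"
    unfolding satisfies_def
  proof
    fix g assume "g \<in> hom Fm FOUR"
    then have "g \<circ> r \<in> hom Fm FOUR"
      using hom_comp r by blast
    then show "g (fst (r \<phi>, r \<psi>)) = g (snd (r \<phi>, r \<psi>))"
      using k(2) by (auto simp: satisfies_def)
  qed
  ultimately show thesis
    using that[of h "r \<phi>" "r \<psi>"] h k by (simp add: h_def)
qed

lemma Alg_LB_in_variety:
  assumes "A \<in> Alg_LB"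
  shows "A \<in> variety_generated_by FOUR"
proof -
  obtain C where C: "LB_g_model A C" "reduced A C"
    using assms by (auto simp: Alg_LB_def)
  then have alg: "algebra A"
    by (simp add: LB_g_model_def g_matrix_def)
  let ?R = "FOUR_pairs A"
  have R_carrier: "?R \<subseteq> carrier A \<times> carrier A"
    by (auto simp: FOUR_pairs_def hom_Fm_carrier)
  then have T_carrier: "?R\<^sup>+ \<subseteq> carrier A \<times> carrier A"
    by (rule trancl_subset_Sigma)
  have R_refl: "(a, a) \<in> ?R" if "a \<in> carrier A" for a
  proof -
    have "eval A (\<lambda>_. a) \<in> hom Fm A" "a = eval A (\<lambda>_. a) (Var 0)" "satisfies FOUR (Var 0, Var 0)"
      using eval_hom[OF alg] that by (auto simp: satisfies_def)
    then show ?thesis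
      unfolding FOUR_pairs_def by blast
  qed
  have "sym ?R"
    by (rule symI) (fastforce simp: FOUR_pairs_def satisfies_def)
  then have T_equiv: "equiv (carrier A) (?R\<^sup>+)"
    using T_carrier R_refl by (intro equivI) (auto simp: refl_on_def sym_trancl)
  \<comment> \<open>Only one argument moves at a time: the fixed one is the value of a variable, so
    a single homomorphism suffices.\<close>
  have R_left: "(bin A c x a, bin A c y a) \<in> ?R" and R_right: "(bin A c a x, bin A c a y) \<in> ?R"
    if xy: "(x, y) \<in> ?R" and a: "a \<in> carrier A" for c x y a
  proof -
    obtain h \<phi> \<psi> where h: "h \<in> hom Fm A" "satisfies FOUR (\<phi>, \<psi>)" "h \<phi> = x" "h \<psi> = y" "h (Var 0) = a"
      using FOUR_pairs_fresh[OF alg xy a] .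
    have "bin A c x a = h (Bin c \<phi> (Var 0))" "bin A c y a = h (Bin c \<psi> (Var 0))"
      "bin A c a x = h (Bin c (Var 0) \<phi>)" "bin A c a y = h (Bin c (Var 0) \<psi>)"
      using h by (auto simp: hom_Fm_Bin)
    moreover have "satisfies FOUR (Bin c \<phi> (Var 0), Bin c \<psi> (Var 0))"
      "satisfies FOUR (Bin c (Var 0) \<phi>, Bin c (Var 0) \<psi>)"
      using h(2) by (auto simp: satisfies_def hom_Fm_Bin)
    ultimately show "(bin A c x a, bin A c y a) \<in> ?R" "(bin A c a x, bin A c a y) \<in> ?R"
      using h(1) unfolding FOUR_pairs_def by blast+
  qed
  have R_neg: "(neg A x, neg A y) \<in> ?R" if xy: "(x, y) \<in> ?R" for x y
  proof -
    obtain h \<phi> \<psi> where h: "h \<in> hom Fm A" "satisfies FOUR (\<phi>, \<psi>)" "x = h \<phi>" "y = h \<psi>"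
      using xy by (auto simp: FOUR_pairs_def)
    have "neg A x = h (Neg \<phi>)" "neg A y = h (Neg \<psi>)" "satisfies FOUR (Neg \<phi>, Neg \<psi>)"
      using h by (auto simp: hom_Fm_Neg satisfies_def)
    then show ?thesis
      using h(1) unfolding FOUR_pairs_def by blast
  qed
  have map: "(f x, f y) \<in> ?R\<^sup>+" if "(x, y) \<in> ?R\<^sup>+" "\<And>x y. (x, y) \<in> ?R \<Longrightarrow> (f x, f y) \<in> ?R" for f x y
    using that(1) by induction (auto intro: that(2) trancl_into_trancl)
  \<comment> \<open>The two arguments are changed in turn, passing through
    \<open>bin A c b a'\<close>.\<close>
  have "(bin A c a a', bin A c b b') \<in> ?R\<^sup>+" if "(a, b) \<in> ?R\<^sup>+" "(a', b') \<in> ?R\<^sup>+" for c a b a' b'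
  proof -
    have "a' \<in> carrier A" "b \<in> carrier A"
      using that T_carrier by auto
    then have "(bin A c a a', bin A c b a') \<in> ?R\<^sup>+" "(bin A c b a', bin A c b b') \<in> ?R\<^sup>+"
      using map[OF that(1), of "\<lambda>x. bin A c x a'"] map[OF that(2), of "bin A c b"] R_left R_right
      by auto
    then show ?thesis by (rule trancl_trans)
  qed
  then have "congruence A (?R\<^sup>+)"
    using T_equiv map[where f = "neg A"] R_neg by (auto simp: congruence_def)
  moreover have "compatible (?R\<^sup>+) F" if "F \<in> C" for F
  proof -
    have F: "LB_filter A F"
      using C(1) that by (simp add: LB_g_model_def)
    have R: "y \<in> F" if "(x, y) \<in> ?R" "x \<in> F" for x y
    proof -
      obtain h \<phi> \<psi> where h: "h \<in> hom Fm A" "satisfies FOUR (\<phi>, \<psi>)" "x = h \<phi>" "y = h \<psi>"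
        using \<open>(x, y) \<in> ?R\<close> by (auto simp: FOUR_pairs_def)
      \<comment> \<open>Formulas with equal values in \<open>FOUR\<close> entail each other, so
        filters respect the pair.\<close>
      then have "LB_entails {\<phi>} \<psi>" "h ` {\<phi>} \<subseteq> F"
        using \<open>x \<in> F\<close> by (auto simp: LB_entails_def satisfies_def)
      then show ?thesis
        using F h unfolding LB_filter_def by blast
    qed
    have "y \<in> F" if "(x, y) \<in> ?R\<^sup>+" "x \<in> F" for x y
      using that by induction (auto intro: R)
    then show ?thesis
      by (auto simp: compatible_def)
  qed
  ultimately have "?R\<^sup>+ \<subseteq> Id_on (carrier A)"
    using C(2) by (auto simp: reduced_def is_Tarski_congruence_def)
  then have T_eq: "x = y" if "(x, y) \<in> ?R" for x y
    using that by (blast dest: r_into_trancl)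
  have "h (fst e) = h (snd e)" if "h \<in> hom Fm A" "satisfies FOUR e" for h e
  proof (rule T_eq)
    show "(h (fst e), h (snd e)) \<in> ?R"
      unfolding FOUR_pairs_def using that by (metis (mono_tags, lifting) mem_Collect_eq prod.collapse)
  qed
  then have "satisfies A e" if "satisfies FOUR e" for e
    using that by (simp add: satisfies_def[of A])
  then show ?thesis
    using alg by (simp add: in_variety_FOUR_iff)
qed

theorem theorem3p4p5:
  shows "(Alg_LB :: 'a alg set) = variety_generated_by FOUR
    \<and> (variety_generated_by FOUR :: 'a alg set) = HSP FOUR
    \<and> (variety_generated_by FOUR :: 'a alg set) = {A. distributive_bilattice A}"
proof -
  \<comment> \<open>This closes the cycle: \<open>HSP FOUR\<close> and \<open>Alg_LB\<close> lie in
    the variety, whose members are distributive bilattices.\<close>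
  have "A \<in> HSP FOUR \<and> A \<in> Alg_LB" if "distributive_bilattice A" for A :: "'a alg"
  proof -
    interpret distr_bilattice A
      using that by unfold_locales
    show ?thesis
      using separated_in_HSP[OF alg separated] separated_in_Alg_LB[OF alg separated] by blast
  qed
  then show ?thesis
    using Alg_LB_in_variety HSP_in_variety variety_FOUR_distributive_bilattice by blast
qed

end
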